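(* Let $\{\mathcal{T}(t)\}_{t\ge 0}$ be the symmetric telegraph process with speed $c>0$ and rate $\lambda>0$, and let $t>0$. For every integer $k\ge 0$ and $0<\beta<ct$, $$P\Bigl\{ \max_{0\le s\le t} \mathcal{T}(s) < \beta \,\Big|\, V(0) = c,\ N(t) = 2k+2\Bigr\} = P\Bigl\{ \max_{0\le s\le t} \mathcal{T}(s) < \beta \,\Big|\, V(0) = c,\ N(t) = 2k+1\Bigr\} = \frac{\beta}{ct} \sum_{j=0}^k \binom{2j}{j}\Bigl( \frac{\sqrt{c^2t^2-\beta^2}}{2ct}\Bigr)^{2j} .$$
   Context: Let $c>0$, $\lambda>0$. Let $V(0)$ be a random variable with $P\{V(0)=c\}=P\{V(0)=-c\}=\tfrac12$ and let $\{N(t)\}_{t\ge0}$ be a homogeneous Poisson process with rate $\lambda$, independent of $V(0)$. The symmetric telegraph process is $\mathcal{T}(t)=\int_0^t V(0)(-1)^{N(s)}\,ds$, $t\ge 0$ (so $\mathcal{T}(0)=0$). *)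

theory Defs
  imports "HOL-Probability.Probability"
begin

text \<open>
  The process is indexed by \<^typ>\<open>real\<close>, but only times \<open>t \<ge> 0\<close> are constrained. Increments
  are truncated differences of natural numbers; as paths are nondecreasing on \<open>[0, \<infinity>)\<close>,
  the truncation never takes effect.
\<close>

locale poisson_process = prob_space M for M :: "'a measure" +
  fixes rate :: real and N :: "real \<Rightarrow> 'a \<Rightarrow> nat"
  assumes rate_pos: "0 < rate"
    and N_measurable: "\<And>t. 0 \<le> t \<Longrightarrow> random_variable (count_space UNIV) (N t)"
    and N_zero: "\<And>\<omega>. \<omega> \<in> space M \<Longrightarrow> N 0 \<omega> = 0"
    and N_mono: "\<And>\<omega>. \<omega> \<in> space M \<Longrightarrow> mono_on {0..} (\<lambda>t. N t \<omega>)"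
    and N_right_continuous:
      "\<And>\<omega> t. \<omega> \<in> space M \<Longrightarrow> 0 \<le> t \<Longrightarrow> continuous (at_right t) (\<lambda>s. N s \<omega>)"
    and independent_increments:
      "\<And>(\<tau> :: nat \<Rightarrow> real) n. 0 \<le> \<tau> 0 \<Longrightarrow> (\<And>i. i < n \<Longrightarrow> \<tau> i < \<tau> (Suc i)) \<Longrightarrow>
         indep_vars (\<lambda>_. count_space UNIV) (\<lambda>i \<omega>. N (\<tau> (Suc i)) \<omega> - N (\<tau> i) \<omega>) {..<n}"
    and poisson_increments:
      "\<And>s t. 0 \<le> s \<Longrightarrow> s < t \<Longrightarrow>
         distr M (count_space UNIV) (\<lambda>\<omega>. N t \<omega> - N s \<omega>) = measure_pmf (poisson_pmf (rate * (t - s)))"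

text \<open>
  Independence of \<open>V0\<close> from the whole process is independence of the generated
  \<open>\<sigma>\<close>-algebras, the second one being generated by the path map into the product space
  over all times \<open>t \<ge> 0\<close>.
\<close>

locale symmetric_telegraph = poisson_process M rate N
  for M :: "'a measure" and rate :: real and N :: "real \<Rightarrow> 'a \<Rightarrow> nat" +
  fixes c :: real and V0 :: "'a \<Rightarrow> real"
  assumes speed_pos: "0 < c"
    and V0_measurable: "random_variable borel V0"
    and V0_pos: "\<P>(\<omega> in M. V0 \<omega> = c) = 1 / 2"
    and V0_neg: "\<P>(\<omega> in M. V0 \<omega> = - c) = 1 / 2"
    and V0_N_indep:
      "indep_set (sets (vimage_algebra (space M) V0 borel))
         (sets (vimage_algebra (space M) (\<lambda>\<omega>. \<lambda>t\<in>{0..}. N t \<omega>)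
            (Pi\<^sub>M {0..} (\<lambda>_. count_space UNIV))))"

definition telegraph :: "('a \<Rightarrow> real) \<Rightarrow> (real \<Rightarrow> 'a \<Rightarrow> nat) \<Rightarrow> real \<Rightarrow> 'a \<Rightarrow> real" where
  "telegraph V0 N t \<omega> = integral {0..t} (\<lambda>s. V0 \<omega> * (- 1) ^ N s \<omega>)"

text \<open>
  \<^const>\<open>Max\<close> is meaningful for finite sets only, so the maximum over \<open>[0, t]\<close> is written as a
  supremum; lemma \<open>telegraph_sup_attained\<close> below shows that it is a maximum.
\<close>

definition telegraph_max :: "('a \<Rightarrow> real) \<Rightarrow> (real \<Rightarrow> 'a \<Rightarrow> nat) \<Rightarrow> real \<Rightarrow> 'a \<Rightarrow> real" where
  "telegraph_max V0 N t \<omega> = (SUP s\<in>{0..t}. telegraph V0 N s \<omega>)"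

context poisson_process
begin

lemma telegraph_integrand_integrable:
  fixes V0 :: "'a \<Rightarrow> real"
  assumes "\<omega> \<in> space M"
  shows "(\<lambda>s. V0 \<omega> * (- 1) ^ N s \<omega>) integrable_on {0..t}"
proof -
  have "mono_on {0..t} (\<lambda>s. real (N s \<omega>))"
    using N_mono[OF assms] by (auto simp: mono_on_def)
  then have "(\<lambda>s. real (N s \<omega>)) \<in> borel_measurable (restrict_space borel {0..t})"
    by (rule borel_measurable_mono_on_fnc)
  then have "(\<lambda>s. V0 \<omega> * cos (pi * real (N s \<omega>))) \<in> borel_measurable (restrict_space borel {0..t})"
    by measurable
  then have "(\<lambda>s. V0 \<omega> * (- 1) ^ N s \<omega>) \<in> borel_measurable (restrict_space borel {0..t})"
    by (simp add: cos_npi2)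
  then have "set_integrable lborel {0..t} (\<lambda>s. V0 \<omega> * (- 1) ^ N s \<omega>)"
    unfolding set_integrable_def
    by (intro integrableI_bounded_set[where A = "{0..t}" and B = "\<bar>V0 \<omega>\<bar>"])
       (auto simp: borel_measurable_restrict_space_iff abs_mult power_abs emeasure_lborel_Icc_eq)
  then show ?thesis
    by (rule set_borel_integral_eq_integral(1))
qed

lemma telegraph_continuous_on:
  assumes "\<omega> \<in> space M"
  shows "continuous_on {0..t} (\<lambda>s. telegraph V0 N s \<omega>)"
  unfolding telegraph_def
  by (rule indefinite_integral_continuous_1[OF telegraph_integrand_integrable[OF assms]])

lemma telegraph_sup_attained:
  assumes "\<omega> \<in> space M" and "0 \<le> t"
  obtains s where "s \<in> {0..t}" and "telegraph_max V0 N t \<omega> = telegraph V0 N s \<omega>"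
    and "\<And>r. r \<in> {0..t} \<Longrightarrow> telegraph V0 N r \<omega> \<le> telegraph_max V0 N t \<omega>"
proof -
  obtain s where s: "s \<in> {0..t}"
    and le: "\<forall>r\<in>{0..t}. telegraph V0 N r \<omega> \<le> telegraph V0 N s \<omega>"
    using continuous_attains_sup[OF compact_Icc _ telegraph_continuous_on[OF assms(1)]] assms(2)
    by fastforce
  have "telegraph_max V0 N t \<omega> = telegraph V0 N s \<omega>"
    unfolding telegraph_max_def by (rule cSup_eq_maximum) (use s le in auto)
  with s le that show ?thesis by auto
qed

end

end

theory Submission
  imports Defs
begin

text \<open>
  Cut \<open>[0, t]\<close> into \<open>m\<close> cells. Given \<open>N t = n\<close>, every pattern of \<open>n\<close> cells carrying one jump each has
  probability \<open>n! / m ^ n\<close>, these patterns exhaust the event as \<open>m \<longlonglongrightarrow> \<infinity>\<close>, and on each of them the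
  telegraph path is within \<open>O(1 / m)\<close> of a lattice walk that reverses direction at the jumps. For
  such a walk with \<open>m = u + v\<close> steps and barrier \<open>h = u - v\<close>, the number of patterns that keep it below
  the barrier is exactly \<open>\<Sum>i. sgn (2 i - n) (u choose i) (v choose (n - i))\<close>, because these signed
  Vandermonde sums and their companions for a downward start obey the same recursion and boundary values.
  In the limit the conditional probability is \<open>P(B > n / 2) - P(B < n / 2)\<close> for \<open>B\<close> binomial with
  parameters \<open>n\<close> and \<open>p = (1 + \<beta> / (c t)) / 2\<close>. Passing from \<open>2 k\<close> to \<open>2 k + 1\<close> trials adds the contribution
  \<open>(2 k choose k) (p q) ^ k (p - q)\<close> of the tie (with \<open>q = 1 - p\<close>), and passing from \<open>2 k + 1\<close> to
  \<open>2 k + 2\<close> adds nothing.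
\<close>

subsection \<open>Signed Vandermonde sums\<close>

text \<open>Without \<open>sgn\<close> this would be Vandermonde's sum for
  \<open>u + v choose n\<close>. The shift \<open>s\<close> is \<open>0\<close> for walks that start
  upwards and \<open>1\<close> for walks that start downwards.\<close>

definition signed_vandermonde :: "int \<Rightarrow> nat \<Rightarrow> nat \<Rightarrow> nat \<Rightarrow> int" where
  "signed_vandermonde s u v n =
     (\<Sum>i\<le>n. sgn (2 * int i + s - int n) * int ((u choose i) * (v choose (n - i))))"

lemma signed_vandermonde_0_0 [simp]: "signed_vandermonde 0 u v 0 = 0"
  and signed_vandermonde_1_0 [simp]: "signed_vandermonde 1 u v 0 = 1"
  by (simp_all add: signed_vandermonde_def)

text \<open>Pascal's rule in \<open>u\<close>. Replacing \<open>i\<close> by \<open>i + 1\<close>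
  turns \<open>2 i - (n + 1)\<close> into \<open>2 i + 1 - n\<close>, so \<open>s\<close> switches
  from \<open>0\<close> to \<open>1\<close>.\<close>

lemma signed_vandermonde_0_Suc:
  "signed_vandermonde 0 (Suc u) v (Suc n) =
     signed_vandermonde 0 u v (Suc n) + signed_vandermonde 1 u v n"
  unfolding signed_vandermonde_def sum.atMost_Suc_shift
  by (simp add: algebra_simps sum.distrib)

text \<open>Pascal's rule in \<open>v\<close>, with \<open>i\<close> unmoved: the sign argument
  \<open>2 i + 1 - (n + 1)\<close> is already the one for \<open>s = 0\<close> and
  \<open>n\<close>.\<close>

lemma signed_vandermonde_1_Suc:
  "signed_vandermonde 1 u (Suc v) (Suc n) =
     signed_vandermonde 1 u v (Suc n) + signed_vandermonde 0 u v n"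
proof -
  have "(\<Sum>i\<le>n. sgn (2 * int i + 1 - int (Suc n)) * int ((u choose i) * (Suc v choose (Suc n - i)))) =
     (\<Sum>i\<le>n. sgn (2 * int i + 1 - int (Suc n)) * int ((u choose i) * (v choose (Suc n - i))))
     + signed_vandermonde 0 u v n"
    unfolding signed_vandermonde_def sum.distrib[symmetric]
    by (intro sum.cong) (auto simp: Suc_diff_le algebra_simps)
  then show ?thesis
    by (simp add: signed_vandermonde_def)
qed

text \<open>Reflecting \<open>i\<close> to \<open>n - i\<close> swaps the two binomials and negates
  the sign, so the sum equals its own negative. This is the boundary value for an upward start on
  the barrier.\<close>

lemma signed_vandermonde_diag: "signed_vandermonde 0 u u n = 0"
proof -
  have "signed_vandermonde 0 u u n =
      (\<Sum>i\<le>n. sgn (2 * int (n - i) - int n) * int ((u choose (n - i)) * (u choose (n - (n - i)))))"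
    unfolding signed_vandermonde_def
    by (subst sum.atLeastAtMost_rev[of _ 0 n, simplified atLeast0AtMost]) simp
  also have "\<dots> = (\<Sum>i\<le>n. - (sgn (2 * int i - int n) * int ((u choose i) * (u choose (n - i)))))"
    by (intro sum.cong) (auto simp: of_nat_diff sgn_if)
  also have "\<dots> = - signed_vandermonde 0 u u n"
    by (simp add: signed_vandermonde_def sum_negf)
  finally show ?thesis by simp
qed

text \<open>Only \<open>i = n\<close> survives, and its sign is that of \<open>n + 1\<close>. This
  is the boundary value for a downward start with the barrier out of reach.\<close>

lemma signed_vandermonde_1_right_0: "signed_vandermonde 1 u 0 n = int (u choose n)"
proof -
  have "signed_vandermonde 1 u 0 n = (\<Sum>i\<le>n. if i = n then int (u choose n) else 0)"
    unfolding signed_vandermonde_def by (intro sum.cong) auto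
  then show ?thesis by simp
qed

section \<open>Limits of the signed sums\<close>

lemma tendsto_ratio_if_bounded_error:
  fixes u :: "nat \<Rightarrow> nat"
  assumes "\<And>m. \<bar>real (u m) - p * real m\<bar> \<le> C"
  shows "(\<lambda>m. real (u m) / real m) \<longlonglongrightarrow> p"
proof (rule Lim_transform2)
  show "(\<lambda>m. p) \<longlonglongrightarrow> p" by simp
  show "(\<lambda>m. p - real (u m) / real m) \<longlonglongrightarrow> 0"
  proof (rule Lim_null_comparison)
    show "\<forall>\<^sub>F m in sequentially. norm (p - real (u m) / real m) \<le> C * (1 / real m)"
      using eventually_gt_at_top[of 0]
    proof eventually_elim
      case (elim m)
      then have "p - real (u m) / real m = - (real (u m) - p * real m) / real m"
        by (simp add: field_simps)
      then show ?case
        using assms[of m] elim by (simp add: divide_right_mono)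
    qed
    show "(\<lambda>m. C * (1 / real m)) \<longlonglongrightarrow> 0"
      using tendsto_mult[OF tendsto_const lim_1_over_n, of C] by simp
  qed
qed

text \<open>\<open>fact i * (u choose i)\<close> is a falling factorial, and its factors divided by
  \<open>m\<close> are \<open>u / m - j / m\<close>.\<close>

lemma choose_asymptotics:
  fixes u :: "nat \<Rightarrow> nat"
  assumes "(\<lambda>m. real (u m) / real m) \<longlonglongrightarrow> p"
  shows "(\<lambda>m. fact i * real (u m choose i) / real m ^ i) \<longlonglongrightarrow> p ^ i"
proof -
  have "(\<lambda>m. \<Prod>j<i. (real (u m) / real m - real j * (1 / real m))) \<longlonglongrightarrow> (\<Prod>j<i. p - real j * 0)"
    by (intro tendsto_prod tendsto_diff assms tendsto_mult tendsto_const lim_1_over_n)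
  moreover have "(\<Prod>j<i. (real (u m) / real m - real j * (1 / real m))) =
      fact i * real (u m choose i) / real m ^ i" for m
    by (simp add: binomial_gbinomial gbinomial_prod_rev atLeast0LessThan
        diff_divide_distrib[symmetric] prod_dividef)
  ultimately show ?thesis by simp
qed

lemma signed_vandermonde_asymptotics:
  fixes u v :: "nat \<Rightarrow> nat"
  assumes "(\<lambda>m. real (u m) / real m) \<longlonglongrightarrow> p" "(\<lambda>m. real (v m) / real m) \<longlonglongrightarrow> q"
  shows "(\<lambda>m. fact n * of_int (signed_vandermonde 0 (u m) (v m) n) / real m ^ n)
    \<longlonglongrightarrow> (\<Sum>i\<le>n. sgn (2 * real i - real n) * real (n choose i) * p ^ i * q ^ (n - i))"
proof -
  have "fact n * of_int (signed_vandermonde 0 (u m) (v m) n) / real m ^ n =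
     (\<Sum>i\<le>n. sgn (2 * real i - real n) * real (n choose i) *
        (fact i * real (u m choose i) / real m ^ i) *
        (fact (n - i) * real (v m choose (n - i)) / real m ^ (n - i)))" for m
  proof -
    have "fact n * (sgn (2 * real i - real n) * (real (u m choose i) * real (v m choose (n - i)))) / real m ^ n =
       sgn (2 * real i - real n) * real (n choose i) *
        (fact i * real (u m choose i) / real m ^ i) *
        (fact (n - i) * real (v m choose (n - i)) / real m ^ (n - i))" if "i \<le> n" for i
    proof -
      have "(fact n :: real) = fact i * fact (n - i) * real (n choose i)"
        using binomial_fact_lemma[OF that] by (metis of_nat_fact of_nat_mult)
      moreover have "real m ^ n = real m ^ i * real m ^ (n - i)"
        using that by (simp flip: power_add)
      ultimately show ?thesis by simp
    qed
    moreover have "real_of_int (sgn (2 * int i - int n)) = sgn (2 * real i - real n)" for i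
      by (auto simp: sgn_if)
    ultimately show ?thesis
      by (simp add: signed_vandermonde_def sum_distrib_left sum_divide_distrib)
  qed
  moreover have "(\<lambda>m. \<Sum>i\<le>n. sgn (2 * real i - real n) * real (n choose i) *
        (fact i * real (u m choose i) / real m ^ i) *
        (fact (n - i) * real (v m choose (n - i)) / real m ^ (n - i)))
    \<longlonglongrightarrow> (\<Sum>i\<le>n. sgn (2 * real i - real n) * real (n choose i) * p ^ i * q ^ (n - i))"
    by (intro tendsto_sum tendsto_mult tendsto_const choose_asymptotics assms)
  ultimately show ?thesis by simp
qed

section \<open>Differences of binomial tails\<close>

definition binomial_sign :: "real \<Rightarrow> real \<Rightarrow> nat \<Rightarrow> real" where
  "binomial_sign p q n = (\<Sum>i\<le>n. sgn (2 * real i - real n) * real (n choose i) * p ^ i * q ^ (n - i))"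

text \<open>For binomial \<open>B\<close> the quantity is the expectation of
  \<open>sgn (2 B - n)\<close>. Conditioning on one more trial moves \<open>2 B - n\<close> down by
  one with probability \<open>q\<close> and up by one with probability \<open>p\<close>.\<close>

lemma binomial_sign_Suc:
  assumes "p + q = 1"
  shows "binomial_sign p q (Suc n) = binomial_sign p q n +
     (\<Sum>i\<le>n. (q * sgn (2 * real i - real n - 1) + p * sgn (2 * real i - real n + 1)
        - sgn (2 * real i - real n)) * (real (n choose i) * p ^ i * q ^ (n - i)))"
proof -
  \<comment> \<open>The left side collects the terms in which the additional trial fails, after
    Pascal's rule and the index shift. The sum may be extended to \<open>i = n + 1\<close> because
    \<open>n choose (n + 1)\<close> is \<open>0\<close>.\<close>
  have *: "(\<Sum>i\<le>n. f (Suc i) * real (n choose Suc i) * p ^ Suc i * q ^ (n - i)) + f 0 * q ^ Suc n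
     = (\<Sum>i\<le>n. f i * q * real (n choose i) * p ^ i * q ^ (n - i))" for f :: "nat \<Rightarrow> real"
  proof -
    have "(\<Sum>i\<le>n. f i * q * real (n choose i) * p ^ i * q ^ (n - i)) =
       (\<Sum>i\<le>n. f i * real (n choose i) * p ^ i * q ^ (Suc n - i))"
      by (intro sum.cong) (auto simp: Suc_diff_le)
    also have "\<dots> = (\<Sum>i\<le>Suc n. f i * real (n choose i) * p ^ i * q ^ (Suc n - i))"
      by simp
    finally show ?thesis by (simp add: sum.atMost_Suc_shift del: sum.atMost_Suc)
  qed
  have "binomial_sign p q (Suc n) =
     (\<Sum>i\<le>n. (q * sgn (2 * real i - real n - 1) + p * sgn (2 * real i - real n + 1))
         * (real (n choose i) * p ^ i * q ^ (n - i)))"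
    using *[of "\<lambda>i. sgn (2 * real i - real n - 1)"]
    unfolding binomial_sign_def sum.atMost_Suc_shift
    by (simp add: algebra_simps sum.distrib)
  then show ?thesis
    by (simp add: binomial_sign_def algebra_simps sum.distrib sum_subtractf)
qed

text \<open>With \<open>2 k\<close> trials \<open>d = 2 i - 2 k\<close> is even. For
  \<open>d\<close> nonzero all three signs agree and cancel by \<open>p + q = 1\<close>; the tie
  \<open>d = 0\<close> leaves \<open>p - q\<close>.\<close>

lemma binomial_sign_odd:
  assumes "p + q = 1"
  shows "binomial_sign p q (2 * k + 1) = binomial_sign p q (2 * k) + real (2 * k choose k) * (p * q) ^ k * (p - q)"
proof -
  have "(\<Sum>i\<le>2 * k. (q * sgn (2 * real i - real (2 * k) - 1) + p * sgn (2 * real i - real (2 * k) + 1)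
        - sgn (2 * real i - real (2 * k))) * (real (2 * k choose i) * p ^ i * q ^ (2 * k - i)))
     = (\<Sum>i\<le>2 * k. if i = k then (p - q) * (real (2 * k choose k) * p ^ k * q ^ k) else 0)"
  proof (intro sum.cong refl)
    fix i assume "i \<in> {..2 * k}"
    consider "i = k" | "real i \<le> real k - 1" | "real i \<ge> real k + 1" by linarith
    then show "(q * sgn (2 * real i - real (2 * k) - 1) + p * sgn (2 * real i - real (2 * k) + 1)
        - sgn (2 * real i - real (2 * k))) * (real (2 * k choose i) * p ^ i * q ^ (2 * k - i))
      = (if i = k then (p - q) * (real (2 * k choose k) * p ^ k * q ^ k) else 0)"
      by cases (use assms in \<open>auto simp: mult_2 algebra_simps\<close>)
  qed
  then show ?thesis
    using binomial_sign_Suc[OF assms, of "2 * k"] by (simp add: power_mult_distrib algebra_simps)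
qed

text \<open>With an odd number of trials only \<open>d = -1\<close> and \<open>d = 1\<close> change
  the sign. They contribute \<open>p\<close> and \<open>- q\<close> times their binomial weights,
  and these cancel by the symmetry of the binomial coefficients.\<close>

lemma binomial_sign_even:
  assumes "p + q = 1"
  shows "binomial_sign p q (2 * k + 2) = binomial_sign p q (2 * k + 1)"
proof -
  let ?n = "2 * k + 1"
  let ?b = "\<lambda>i. real (?n choose i) * p ^ i * q ^ (?n - i)"
  have sym: "?n choose k = ?n choose Suc k"
    using binomial_symmetric[of k ?n] by simp
  have "(\<Sum>i\<le>?n. (q * sgn (2 * real i - real ?n - 1) + p * sgn (2 * real i - real ?n + 1)
        - sgn (2 * real i - real ?n)) * ?b i)
     = (\<Sum>i\<le>?n. (if i = k then p * ?b k else 0) + (if i = Suc k then - q * ?b (Suc k) else 0))"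
  proof (intro sum.cong refl)
    fix i assume "i \<in> {..?n}"
    consider "i = k" | "i = Suc k" | "real i \<le> real k - 1" | "real i \<ge> real k + 2" by linarith
    then show "(q * sgn (2 * real i - real ?n - 1) + p * sgn (2 * real i - real ?n + 1)
        - sgn (2 * real i - real ?n)) * ?b i
      = (if i = k then p * ?b k else 0) + (if i = Suc k then - q * ?b (Suc k) else 0)"
    proof cases
      case 1 then show ?thesis using assms by simp
    next
      case 2
      have "p - 1 = - q" using assms by simp
      with 2 show ?thesis by simp
    next
      case 3
      then have "i \<noteq> k" "i \<noteq> Suc k" by auto
      have "q + p - 1 = 0" using assms by simp
      with 3 \<open>i \<noteq> k\<close> \<open>i \<noteq> Suc k\<close> show ?thesis by (auto simp: sgn_if)
    next
      case 4
      then have "i \<noteq> k" "i \<noteq> Suc k" by auto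
      have "q + p - 1 = 0" using assms by simp
      with 4 \<open>i \<noteq> k\<close> \<open>i \<noteq> Suc k\<close> show ?thesis by (auto simp: sgn_if)
    qed
  qed
  also have "\<dots> = p * ?b k - q * ?b (Suc k)" by (simp add: sum.distrib)
  also have "\<dots> = 0"
    using sym by (simp add: Suc_diff_le mult_2)
  finally show ?thesis
    using binomial_sign_Suc[OF assms, of ?n] by simp
qed

lemma binomial_sign_closed_form:
  assumes "p + q = 1"
  shows "binomial_sign p q (2 * k + 1) = (p - q) * (\<Sum>j=0..k. real (2 * j choose j) * (p * q) ^ j)"
proof (induction k)
  case 0
  then show ?case using binomial_sign_odd[OF assms, of 0] by (simp add: binomial_sign_def)
next
  case (Suc k)
  then show ?case
    using binomial_sign_odd[OF assms, of "Suc k"] binomial_sign_even[OF assms, of k]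
    by (simp add: algebra_simps)
qed

subsection \<open>Reversing walks below a barrier\<close>

text \<open>
  An entry \<open>True\<close> reverses the direction after the step of its cell, and \<open>h\<close> is the distance to the
  barrier. A walk standing at the barrier is lost only if it is heading up; with this convention the
  count in \<open>card_low_paths\<close> is exact.
\<close>

primrec stays_below :: "bool \<Rightarrow> int \<Rightarrow> bool list \<Rightarrow> bool" where
  "stays_below up h [] \<longleftrightarrow> (up \<longrightarrow> 0 < h)"
| "stays_below up h (x # xs) \<longleftrightarrow> (up \<longrightarrow> 0 < h) \<and> stays_below (up \<noteq> x) (if up then h - 1 else h + 1) xs"

text \<open>Step \<open>i\<close> sees only the reversals in earlier cells, matching the velocity at
  the left end of its cell.\<close>

definition walk_position :: "bool \<Rightarrow> bool list \<Rightarrow> nat \<Rightarrow> int" where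
  "walk_position up xs j = (\<Sum>i<j. (if up then 1 else - 1) * (- 1) ^ count_list (take i xs) True)"

lemma walk_position_0 [simp]: "walk_position up xs 0 = 0"
  by (simp add: walk_position_def)

lemma walk_position_Suc:
  "walk_position up (x # xs) (Suc j) = (if up then 1 else - 1) + walk_position (up \<noteq> x) xs j"
  unfolding walk_position_def sum.lessThan_Suc_shift by (auto simp: sum_negf)

text \<open>A surviving walk may touch the barrier, but only when turning down there. The next lemma
  is a converse up to this touching, which is harmless once heights are scaled by
  \<open>1 / m\<close>.\<close>

lemma walk_position_le_if_stays_below:
  assumes "stays_below up h xs" "0 \<le> h" "j \<le> length xs"
  shows "walk_position up xs j \<le> h"
  using assms
proof (induction xs arbitrary: up h j)
  case (Cons x xs)
  show ?case
  proof (cases j)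
    case (Suc i)
    have "walk_position (up \<noteq> x) xs i \<le> (if up then h - 1 else h + 1)"
      by (rule Cons.IH) (use Cons.prems Suc in auto)
    then show ?thesis by (auto simp: Suc walk_position_Suc)
  qed (use Cons.prems in simp)
qed simp

lemma walk_position_ge_if_not_stays_below:
  assumes "\<not> stays_below up h xs"
  shows "\<exists>j\<le>length xs. h \<le> walk_position up xs j"
  using assms
proof (induction xs arbitrary: up h)
  case (Cons x xs)
  show ?case
  proof (cases "up \<and> h \<le> 0")
    case True
    then show ?thesis by (intro exI[of _ 0]) auto
  next
    case False
    with Cons.prems have "\<not> stays_below (up \<noteq> x) (if up then h - 1 else h + 1) xs" by auto
    from Cons.IH[OF this] obtain j where "j \<le> length xs"
      "(if up then h - 1 else h + 1) \<le> walk_position (up \<noteq> x) xs j" by blast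
    then show ?thesis by (intro exI[of _ "Suc j"]) (auto simp: walk_position_Suc split: if_splits)
  qed
qed auto

definition low_paths :: "bool \<Rightarrow> int \<Rightarrow> nat \<Rightarrow> nat \<Rightarrow> bool list set" where
  "low_paths up h m n = {xs. length xs = m \<and> count_list xs True = n \<and> stays_below up h xs}"

lemma finite_low_paths [simp]: "finite (low_paths up h m n)"
  by (rule finite_subset[OF _ finite_lists_length_eq[of UNIV m]]) (auto simp: low_paths_def)

lemma low_paths_0: "low_paths up h 0 n = (if n = 0 \<and> (up \<longrightarrow> 0 < h) then {[]} else {})"
  by (auto simp: low_paths_def)

text \<open>Case split on the first entry: \<open>True\<close> uses up one of the \<open>n\<close>
  reversals and flips the direction.\<close>

lemma card_low_paths_Suc:
  assumes "up \<longrightarrow> 0 < h"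
  defines "h' \<equiv> if up then h - 1 else h + 1"
  shows "card (low_paths up h (Suc m) n) = card (low_paths up h' m n) +
    (case n of 0 \<Rightarrow> 0 | Suc l \<Rightarrow> card (low_paths (\<not> up) h' m l))"
proof -
  let ?A = "(#) False ` low_paths up h' m n"
  let ?B = "(#) True ` (case n of 0 \<Rightarrow> {} | Suc l \<Rightarrow> low_paths (\<not> up) h' m l)"
  have "low_paths up h (Suc m) n = ?A \<union> ?B"
  proof (intro set_eqI)
    fix xs show "xs \<in> low_paths up h (Suc m) n \<longleftrightarrow> xs \<in> ?A \<union> ?B"
    proof (cases xs)
      case (Cons x ys)
      then show ?thesis using assms(1)
        by (cases x; cases n) (auto simp: low_paths_def h'_def)
    qed (auto simp: low_paths_def)
  qed
  moreover have "card (?A \<union> ?B) = card ?A + card ?B"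
    by (rule card_Un_disjoint) (auto split: nat.split)
  ultimately show ?thesis
    by (auto simp: card_image split: nat.split)
qed

text \<open>The barrier is too far away for \<open>m\<close> steps. A downward start is allowed
  \<open>m = h\<close>, as required by the case \<open>v = 0\<close> of the exact count, where
  \<open>u\<close> steps face the barrier \<open>u\<close>.\<close>

lemma card_low_paths_unconstrained:
  assumes "int m < (if up then h else h + 1)"
  shows "card (low_paths up h m n) = m choose n"
  using assms
proof (induction m arbitrary: up h n)
  case 0
  then show ?case by (auto simp: low_paths_0 split: if_splits)
next
  case (Suc m)
  define h' where "h' = (if up then h - 1 else h + 1)"
  have "card (low_paths up' h' m l) = m choose l" for up' l
    by (rule Suc.IH) (use Suc.prems in \<open>auto simp: h'_def split: if_splits\<close>)
  moreover have "up \<longrightarrow> 0 < h" using Suc.prems by (auto split: if_splits)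
  ultimately show ?case
    using card_low_paths_Suc[of up h m n] by (cases n) (simp_all flip: h'_def)
qed

text \<open>A step up lowers \<open>u - v\<close> by one and is charged to \<open>u\<close>; a step
  down raises it by one and is charged to \<open>v\<close>. The recursions and boundary values
  (\<open>u = v\<close> heading up, \<open>v = 0\<close> heading down) then agree with those of the
  signed sums.\<close>

lemma card_low_paths:
  assumes "v \<le> u"
  shows "int (card (low_paths up (int u - int v) (u + v) n)) =
    signed_vandermonde (if up then 0 else 1) u v n"
  using assms
proof (induction "u + v" arbitrary: u v up n rule: less_induct)
  case less
  show ?case
  proof (cases up)
    case True
    show ?thesis
    proof (cases "u = v")
      case True
      have "low_paths up 0 m n = {}" for m
        using \<open>up\<close> by (cases m) (auto simp: low_paths_def length_Suc_conv)
      with True \<open>up\<close> show ?thesis by (simp add: signed_vandermonde_diag)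
    next
      case False
      then obtain w where w: "u = Suc w" "v \<le> w" using less.prems by (cases u) auto
      show ?thesis
        using \<open>up\<close> w card_low_paths_Suc[of True "int u - int v" "w + v" n]
          less.hyps[of w v] signed_vandermonde_0_Suc[of w v]
        by (cases n) auto
    qed
  next
    case False
    show ?thesis
    proof (cases v)
      case 0
      with False show ?thesis
        using card_low_paths_unconstrained[of u False "int u" n]
        by (simp add: signed_vandermonde_1_right_0)
    next
      case (Suc w)
      have "int (card (low_paths up' (int u - int v + 1) (u + w) l)) =
          signed_vandermonde (if up' then 0 else 1) u w l" for up' l
        using less.hyps[of u w up' l] less.prems Suc by (simp add: algebra_simps)
      moreover have "u + v = Suc (u + w)" using Suc by simp
      ultimately show ?thesis
        using False card_low_paths_Suc[of False "int u - int v" "u + w" n]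
        by (cases n) (simp_all add: signed_vandermonde_1_Suc[of u w] \<open>v = Suc w\<close> del: of_nat_Suc)
    qed
  qed
qed

subsection \<open>Discretised telegraph paths\<close>

lemma count_list_True_eq_sum: "count_list xs True = (\<Sum>i<length xs. of_bool (xs ! i))"
  by (induction xs) (auto simp: sum.lessThan_Suc_shift simp del: sum.lessThan_Suc)

definition jump_event :: "'a measure \<Rightarrow> (real \<Rightarrow> 'a \<Rightarrow> nat) \<Rightarrow> real \<Rightarrow> nat \<Rightarrow> bool list \<Rightarrow> 'a set" where
  "jump_event M N t m xs = {\<omega> \<in> space M. \<forall>i<m.
     N (real (Suc i) * t / real m) \<omega> - N (real i * t / real m) \<omega> = of_bool (xs ! i)}"

text \<open>Times \<open>V0 * t / m\<close>, this is the left Riemann sum of the telegraph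
  integral.\<close>

definition grid_sum :: "(real \<Rightarrow> 'a \<Rightarrow> nat) \<Rightarrow> real \<Rightarrow> nat \<Rightarrow> nat \<Rightarrow> 'a \<Rightarrow> real" where
  "grid_sum N t m j \<omega> = (\<Sum>i<j. (- 1) ^ N (real i * t / real m) \<omega>)"

context poisson_process
begin

section \<open>Pathwise comparison with the grid\<close>

lemma N_le: "\<omega> \<in> space M \<Longrightarrow> 0 \<le> a \<Longrightarrow> a \<le> b \<Longrightarrow> N a \<omega> \<le> N b \<omega>"
  using N_mono by (auto simp: mono_on_def)

lemma telegraph_diff_has_integral:
  assumes "\<omega> \<in> space M" "0 \<le> a" "a \<le> b"
  shows "((\<lambda>s. V0 \<omega> * (- 1) ^ N s \<omega>) has_integral (telegraph V0 N b \<omega> - telegraph V0 N a \<omega>)) {a..b}"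
proof -
  have "integral {a..b} (\<lambda>s. V0 \<omega> * (- 1) ^ N s \<omega>) = telegraph V0 N b \<omega> - telegraph V0 N a \<omega>"
    using Henstock_Kurzweil_Integration.integral_combine[OF assms(2,3) telegraph_integrand_integrable[OF assms(1)], of V0]
    by (simp add: telegraph_def)
  moreover have "(\<lambda>s. V0 \<omega> * (- 1) ^ N s \<omega>) integrable_on {a..b}"
    by (rule integrable_on_subinterval[OF telegraph_integrand_integrable[OF assms(1), of _ b]])
       (use assms in auto)
  ultimately show ?thesis by (metis integrable_integral)
qed

lemma telegraph_lipschitz:
  assumes "\<omega> \<in> space M" "0 \<le> a" "a \<le> b"
  shows "\<bar>telegraph V0 N b \<omega> - telegraph V0 N a \<omega>\<bar> \<le> \<bar>V0 \<omega>\<bar> * (b - a)"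
  using has_integral_bound_real[OF _ finite.emptyI telegraph_diff_has_integral[OF assms], of "\<bar>V0 \<omega>\<bar>"]
    assms(3) by (simp add: abs_mult power_abs)

text \<open>Without a jump the velocity is constant and the error vanishes; otherwise
  \<open>N b - N a\<close> is at least \<open>1\<close> and the velocity is off by at most
  \<open>2 * \<bar>V0\<bar>\<close>. Bounding by the number of jumps lets the errors telescope over
  the cells.\<close>

lemma telegraph_increment:
  assumes "\<omega> \<in> space M" "0 \<le> a" "a \<le> b"
  shows "\<bar>telegraph V0 N b \<omega> - telegraph V0 N a \<omega> - (b - a) * (V0 \<omega> * (- 1) ^ N a \<omega>)\<bar>
    \<le> 2 * \<bar>V0 \<omega>\<bar> * (real (N b \<omega>) - real (N a \<omega>)) * (b - a)"
proof -
  let ?B = "2 * \<bar>V0 \<omega>\<bar> * (real (N b \<omega>) - real (N a \<omega>))"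
  have int: "((\<lambda>s. V0 \<omega> * (- 1) ^ N s \<omega> - V0 \<omega> * (- 1) ^ N a \<omega>) has_integral
     (telegraph V0 N b \<omega> - telegraph V0 N a \<omega> - (b - a) * (V0 \<omega> * (- 1) ^ N a \<omega>))) {a..b}"
    using has_integral_diff[OF telegraph_diff_has_integral[OF assms]
        has_integral_const_real[of "V0 \<omega> * (- 1) ^ N a \<omega>" a b], of V0] assms(3)
    by simp
  have bound: "\<bar>V0 \<omega> * (- 1) ^ N s \<omega> - V0 \<omega> * (- 1) ^ N a \<omega>\<bar> \<le> ?B" if "s \<in> {a..b}" for s
  proof (cases "N s \<omega> = N a \<omega>")
    case True
    then show ?thesis using N_le[OF assms] by simp
  next
    case False
    with that N_le[OF assms(1,2), of s] N_le[OF assms(1), of s b] assms(2)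
    have "1 \<le> real (N b \<omega>) - real (N a \<omega>)" by auto
    then have "2 * \<bar>V0 \<omega>\<bar> * 1 \<le> ?B" by (intro mult_left_mono) auto
    moreover have "\<bar>V0 \<omega> * (- 1) ^ N s \<omega> - V0 \<omega> * (- 1) ^ N a \<omega>\<bar> \<le> 2 * \<bar>V0 \<omega>\<bar>"
      using abs_triangle_ineq4[of "V0 \<omega> * (- 1) ^ N s \<omega>" "V0 \<omega> * (- 1) ^ N a \<omega>"]
      by (simp add: abs_mult power_abs)
    ultimately show ?thesis by simp
  qed
  have "0 \<le> ?B" using N_le[OF assms] by simp
  from has_integral_bound_real[OF this finite.emptyI int] show ?thesis
    using bound assms(3) by simp
qed

lemma telegraph_grid_approx:
  assumes "\<omega> \<in> space M" "0 \<le> t"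
  shows "\<bar>telegraph V0 N (real j * t / real m) \<omega> - V0 \<omega> * t / real m * grid_sum N t m j \<omega>\<bar>
    \<le> 2 * \<bar>V0 \<omega>\<bar> * t / real m * real (N (real j * t / real m) \<omega>)"
proof (induction j)
  case 0
  then show ?case using assms(1) N_zero by (simp add: telegraph_def grid_sum_def)
next
  case (Suc j)
  have "real (Suc j) * t / real m - real j * t / real m = t / real m"
    by (simp add: algebra_simps add_divide_distrib)
  moreover have "0 \<le> real j * t / real m" "real j * t / real m \<le> real (Suc j) * t / real m"
    using assms(2) by (auto intro!: divide_right_mono mult_right_mono)
  ultimately have "\<bar>telegraph V0 N (real (Suc j) * t / real m) \<omega> - telegraph V0 N (real j * t / real m) \<omega>
      - (t / real m) * (V0 \<omega> * (- 1) ^ N (real j * t / real m) \<omega>)\<bar>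
    \<le> 2 * \<bar>V0 \<omega>\<bar> * (real (N (real (Suc j) * t / real m) \<omega>) - real (N (real j * t / real m) \<omega>)) * (t / real m)"
    using telegraph_increment[OF assms(1), of "real j * t / real m" "real (Suc j) * t / real m" V0]
    by (simp only: simp_thms)
  moreover have "V0 \<omega> * t / real m * grid_sum N t m (Suc j) \<omega> = V0 \<omega> * t / real m * grid_sum N t m j \<omega>
      + (t / real m) * (V0 \<omega> * (- 1) ^ N (real j * t / real m) \<omega>)"
    by (simp add: grid_sum_def algebra_simps)
  moreover have "2 * \<bar>V0 \<omega>\<bar> * t / real m * real (N (real (Suc j) * t / real m) \<omega>) =
      2 * \<bar>V0 \<omega>\<bar> * t / real m * real (N (real j * t / real m) \<omega>) +
      2 * \<bar>V0 \<omega>\<bar> * (real (N (real (Suc j) * t / real m) \<omega>) - real (N (real j * t / real m) \<omega>)) * (t / real m)"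
    by (simp add: algebra_simps add_divide_distrib diff_divide_distrib)
  ultimately show ?case using Suc.IH by linarith
qed

lemma telegraph_le_max:
  assumes "\<omega> \<in> space M" "s \<in> {0..t}"
  shows "telegraph V0 N s \<omega> \<le> telegraph_max V0 N t \<omega>"
proof -
  have "0 \<le> t" using assms(2) by simp
  from telegraph_sup_attained[OF assms(1) this, of V0] assms(2) show ?thesis by metis
qed

lemma grid_sum_le_telegraph_max:
  assumes "\<omega> \<in> space M" "0 \<le> t" "j \<le> m" "0 \<le> V0 \<omega>"
  shows "V0 \<omega> * t / real m * (grid_sum N t m j \<omega> - 2 * real (N t \<omega>)) \<le> telegraph_max V0 N t \<omega>"
proof -
  have s: "real j * t / real m \<in> {0..t}"
    using assms(2,3) by (cases "m = 0") (auto simp: field_simps intro: mult_left_mono)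
  have "2 * \<bar>V0 \<omega>\<bar> * t / real m * real (N (real j * t / real m) \<omega>) \<le> 2 * \<bar>V0 \<omega>\<bar> * t / real m * real (N t \<omega>)"
    using N_le[OF assms(1), of "real j * t / real m" t] s assms(2) by (intro mult_left_mono) auto
  then show ?thesis
    using telegraph_grid_approx[OF assms(1,2), of V0 j m] telegraph_le_max[OF assms(1) s, of V0] assms(4)
    by (simp add: algebra_simps abs_le_iff)
qed

text \<open>A maximiser lies at most one cell to the right of some grid point, and the Lipschitz
  bound pays for this distance with the summand \<open>1\<close>.\<close>

lemma telegraph_max_le_grid_sum:
  assumes "\<omega> \<in> space M" "0 < t" "0 < m" "0 \<le> V0 \<omega>"
    and H: "\<And>j. j \<le> m \<Longrightarrow> grid_sum N t m j \<omega> \<le> H"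
  shows "telegraph_max V0 N t \<omega> \<le> V0 \<omega> * t / real m * (H + 2 * real (N t \<omega>) + 1)"
proof -
  obtain s where s: "s \<in> {0..t}" and max: "telegraph_max V0 N t \<omega> = telegraph V0 N s \<omega>"
    using telegraph_sup_attained[OF assms(1) less_imp_le[OF assms(2)], of V0] by metis
  define j where "j = nat \<lfloor>s * real m / t\<rfloor>"
  let ?a = "real j * t / real m"
  have nn: "0 \<le> s * real m / t" using s assms by auto
  have j: "real j \<le> s * real m / t" "s * real m / t \<le> real j + 1"
    using nn unfolding j_def by linarith+
  have "s * real m / t \<le> real m"
    using s assms(2,3) by (simp add: field_simps mult_right_mono)
  with j(1) have "j \<le> m" by linarith
  have a: "0 \<le> ?a" "?a \<le> s" "s - ?a \<le> t / real m"
    using j assms(2,3) by (simp_all add: pos_divide_le_eq pos_le_divide_eq diff_le_eq add_divide_distrib[symmetric])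
       (simp_all add: algebra_simps)
  have "telegraph V0 N s \<omega> \<le> telegraph V0 N ?a \<omega> + V0 \<omega> * (s - ?a)"
    using telegraph_lipschitz[OF assms(1) a(1,2), of V0] assms(4) by simp
  also have "V0 \<omega> * (s - ?a) \<le> V0 \<omega> * (t / real m)"
    using a(3) assms(4) by (rule mult_left_mono)
  also have "telegraph V0 N ?a \<omega> \<le> V0 \<omega> * t / real m * grid_sum N t m j \<omega>
      + 2 * V0 \<omega> * t / real m * real (N ?a \<omega>)"
    using telegraph_grid_approx[OF assms(1), of t V0 j m] assms(2,4) by (simp add: abs_le_iff)
  also have "V0 \<omega> * t / real m * grid_sum N t m j \<omega> \<le> V0 \<omega> * t / real m * H"
    using H[OF \<open>j \<le> m\<close>] assms(2,4) by (intro mult_left_mono) auto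
  also have "2 * V0 \<omega> * t / real m * real (N ?a \<omega>) \<le> 2 * V0 \<omega> * t / real m * real (N t \<omega>)"
    using N_le[OF assms(1), of ?a t] a s assms(2,4) by (intro mult_left_mono) auto
  finally show ?thesis by (simp add: max algebra_simps)
qed

text \<open>
  The measurable space \<open>W\<close> is left open so that it can later be instantiated with the
  \<open>\<sigma>\<close>-algebra generated by \<open>N\<close>, which is the one independent of \<open>V0\<close>.
\<close>

lemma borel_measurable_telegraph_max:
  assumes W: "space W = space M" "\<And>s. 0 \<le> s \<Longrightarrow> N s \<in> measurable W (count_space UNIV)"
    and "0 < t" "0 \<le> c"
  shows "telegraph_max (\<lambda>_. c) N t \<in> borel_measurable W"
proof (rule borel_measurable_LIMSEQ_real)
  \<comment> \<open>The grid maximum involves finitely many \<open>N s\<close>, hence is measurable,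
    and the two preceding comparisons put it within \<open>O(1 / m)\<close> of the supremum.\<close>
  let ?g = "\<lambda>m \<omega>. c * t / real m * Max ((\<lambda>j. grid_sum N t m j \<omega>) ` {..m})"
  have "grid_sum N t m j \<in> borel_measurable W" for m j
    unfolding grid_sum_def using \<open>0 < t\<close>
    by (intro borel_measurable_sum measurable_compose[OF W(2)]) auto
  then show "?g m \<in> borel_measurable W" for m
    by (intro borel_measurable_times borel_measurable_const borel_measurable_Max) auto
  fix \<omega> assume "\<omega> \<in> space W"
  then have \<omega>: "\<omega> \<in> space M" using W by simp
  show "(\<lambda>m. ?g m \<omega>) \<longlonglongrightarrow> telegraph_max (\<lambda>_. c) N t \<omega>"
  proof (rule Lim_transform2[OF tendsto_const])
    show "(\<lambda>m. telegraph_max (\<lambda>_. c) N t \<omega> - ?g m \<omega>) \<longlonglongrightarrow> 0"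
    proof (rule Lim_null_comparison)
      show "\<forall>\<^sub>F m in sequentially. norm (telegraph_max (\<lambda>_. c) N t \<omega> - ?g m \<omega>)
          \<le> c * t * (2 * real (N t \<omega>) + 1) * (1 / real m)"
        using eventually_gt_at_top[of 0]
      proof eventually_elim
        case (elim m)
        let ?S = "(\<lambda>j. grid_sum N t m j \<omega>) ` {..m}"
        have "Max ?S \<in> ?S" by (intro Max_in) auto
        then obtain j where j: "j \<le> m" "Max ?S = grid_sum N t m j \<omega>" by (auto simp only: image_iff atMost_iff)
        have "c * t / real m * (Max ?S - 2 * real (N t \<omega>)) \<le> telegraph_max (\<lambda>_. c) N t \<omega>"
          unfolding j(2) using grid_sum_le_telegraph_max[OF \<omega>, of t j m "\<lambda>_. c"] j(1) assms by simp
        moreover have "telegraph_max (\<lambda>_. c) N t \<omega> \<le> c * t / real m * (Max ?S + 2 * real (N t \<omega>) + 1)"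
          using elim assms by (intro telegraph_max_le_grid_sum \<omega>) auto
        moreover have "0 \<le> c * t / real m" using assms by simp
        ultimately show ?case by (simp add: algebra_simps abs_le_iff add_divide_distrib)
      qed
      show "(\<lambda>m. c * t * (2 * real (N t \<omega>) + 1) * (1 / real m)) \<longlonglongrightarrow> 0"
        using tendsto_mult[OF tendsto_const lim_1_over_n, of "c * t * (2 * real (N t \<omega>) + 1)"] by simp
    qed
  qed
qed

section \<open>Probabilities of jump patterns\<close>

lemma prob_increment:
  assumes "0 \<le> s" "s < t"
  shows "prob ((\<lambda>\<omega>. N t \<omega> - N s \<omega>) -` {l} \<inter> space M) =
    (rate * (t - s)) ^ l / fact l * exp (- (rate * (t - s)))"
proof -
  \<comment> \<open>Measurability of one increment is read off from independence over the partition
    with the single interval from \<open>s\<close> to \<open>t\<close>.\<close>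
  have "(\<lambda>\<omega>. N t \<omega> - N s \<omega>) \<in> measurable M (count_space UNIV)"
    using independent_increments[of "\<lambda>i. if i = 0 then s else t" 1] assms
    by (simp add: indep_vars_def)
  then have "prob ((\<lambda>\<omega>. N t \<omega> - N s \<omega>) -` {l} \<inter> space M) =
      measure (distr M (count_space UNIV) (\<lambda>\<omega>. N t \<omega> - N s \<omega>)) {l}"
    by (simp add: measure_distr)
  also have "\<dots> = pmf (poisson_pmf (rate * (t - s))) l"
    by (simp add: poisson_increments[OF assms] pmf.rep_eq)
  finally show ?thesis using rate_pos assms by simp
qed

lemma prob_N:
  assumes "0 < t"
  shows "prob {\<omega> \<in> space M. N t \<omega> = n} = (rate * t) ^ n / fact n * exp (- (rate * t))"
proof -
  have "{\<omega> \<in> space M. N t \<omega> = n} = (\<lambda>\<omega>. N t \<omega> - N 0 \<omega>) -` {n} \<inter> space M"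
    using N_zero by auto
  then show ?thesis using prob_increment[OF order_refl assms] by simp
qed

text \<open>Independent cells contribute Poisson masses at \<open>0\<close> or \<open>1\<close>,
  whose factorials are both \<open>1\<close>. Hence all patterns with the same number of jumps are
  equally likely.\<close>

lemma
  assumes "0 < t" "0 < m" "length xs = m"
  shows jump_event_measurable: "jump_event M N t m xs \<in> events"
    and prob_jump_event:
      "prob (jump_event M N t m xs) = exp (- (rate * t)) * (rate * t / real m) ^ count_list xs True"
proof -
  let ?\<tau> = "\<lambda>i. real i * t / real m"
  let ?X = "\<lambda>i \<omega>. N (?\<tau> (Suc i)) \<omega> - N (?\<tau> i) \<omega>"
  have less: "?\<tau> i < ?\<tau> (Suc i)" for i using assms by (simp add: field_simps)
  have eq: "jump_event M N t m xs = (\<Inter>i\<in>{..<m}. ?X i -` {of_bool (xs ! i)} \<inter> space M)"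
    using assms(2) by (auto simp: jump_event_def)
  have indep: "indep_vars (\<lambda>_. count_space UNIV) ?X {..<m}"
    by (rule independent_increments) (use less in auto)
  then have X: "?X i \<in> measurable M (count_space UNIV)" if "i < m" for i
    using that by (auto simp: indep_vars_def)
  show "jump_event M N t m xs \<in> events"
    unfolding eq by (intro sets.finite_INT measurable_sets[OF X]) (use assms(2) in auto)
  have "prob (jump_event M N t m xs) = (\<Prod>i<m. prob (?X i -` {of_bool (xs ! i)} \<inter> space M))"
    unfolding eq by (rule indep_varsD[OF indep]) (use assms(2) in auto)
  also have "\<dots> = (\<Prod>i<m. exp (- (rate * t / real m)) * (rate * t / real m) ^ of_bool (xs ! i))"
  proof (intro prod.cong refl)
    fix i assume "i \<in> {..<m}"
    have "?\<tau> (Suc i) - ?\<tau> i = t / real m" by (simp add: algebra_simps add_divide_distrib)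
    moreover have "fact (of_bool (xs ! i)) = (1 :: real)" by (cases "xs ! i") auto
    ultimately show "prob (?X i -` {of_bool (xs ! i)} \<inter> space M) =
        exp (- (rate * t / real m)) * (rate * t / real m) ^ of_bool (xs ! i)"
      using prob_increment[OF _ less, of i "of_bool (xs ! i)"] assms(1) by (simp del: of_nat_Suc)
  qed
  also have "\<dots> = exp (- (rate * t / real m)) ^ m * (rate * t / real m) ^ count_list xs True"
    by (simp only: prod.distrib count_list_True_eq_sum assms(3) power_sum) simp
  also have "exp (- (rate * t / real m)) ^ m = exp (- (rate * t))"
    using assms(2) by (simp flip: exp_of_nat_mult)
  finally show "prob (jump_event M N t m xs) =
      exp (- (rate * t)) * (rate * t / real m) ^ count_list xs True" .
qed

lemma jump_event_unique:
  assumes "\<omega> \<in> jump_event M N t m xs" "\<omega> \<in> jump_event M N t m ys" "length xs = m" "length ys = m"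
  shows "xs = ys"
proof (rule nth_equalityI)
  fix i assume "i < length xs"
  with assms have "of_bool (xs ! i) = (of_bool (ys ! i) :: nat)"
    unfolding jump_event_def by auto
  then show "xs ! i = ys ! i" by (simp only: of_bool_eq_iff)
qed (use assms in simp)

lemma jump_event_count:
  assumes "\<omega> \<in> jump_event M N t m xs" "length xs = m" "i \<le> m" "0 \<le> t"
  shows "count_list (take i xs) True = N (real i * t / real m) \<omega>"
  using assms(3)
proof (induction i)
  case 0
  then show ?case using assms(1) N_zero by (simp add: jump_event_def)
next
  case (Suc i)
  \<comment> \<open>Monotonicity turns the truncated difference in \<open>jump_event\<close> into a
    genuine one.\<close>
  have "real i * t / real m \<le> real (Suc i) * t / real m"
    using assms(4) by (intro divide_right_mono mult_right_mono) auto
  then have "N (real i * t / real m) \<omega> \<le> N (real (Suc i) * t / real m) \<omega>"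
    using assms(1,4) by (intro N_le) (auto simp: jump_event_def)
  moreover have "N (real (Suc i) * t / real m) \<omega> - N (real i * t / real m) \<omega> = of_bool (xs ! i)"
    using assms(1) Suc.prems by (auto simp: jump_event_def)
  ultimately have "N (real (Suc i) * t / real m) \<omega> = N (real i * t / real m) \<omega> + of_bool (xs ! i)"
    by linarith
  with Suc assms(2) show ?case by (simp add: take_Suc_conv_app_nth del: of_nat_Suc)
qed

lemma jump_event_grid_sum:
  assumes "\<omega> \<in> jump_event M N t m xs" "length xs = m" "j \<le> m" "0 \<le> t"
  shows "grid_sum N t m j \<omega> = of_int (walk_position True xs j)"
  unfolding grid_sum_def walk_position_def of_int_sum
  by (intro sum.cong) (use jump_event_count[OF assms(1,2) _ assms(4)] assms(3) in auto)

definition low_event :: "real \<Rightarrow> nat \<Rightarrow> nat \<Rightarrow> int \<Rightarrow> 'a set" where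
  "low_event t m n h = (\<Union>xs\<in>low_paths True h m n. jump_event M N t m xs)"

lemma
  assumes "0 < t" "0 < m"
  shows low_event_measurable: "low_event t m n h \<in> events"
    and prob_low_event: "prob (low_event t m n h) =
      real (card (low_paths True h m n)) * (exp (- (rate * t)) * (rate * t / real m) ^ n)"
proof -
  have len: "length xs = m" if "xs \<in> low_paths True h m n" for xs
    using that by (simp add: low_paths_def)
  then show "low_event t m n h \<in> events"
    unfolding low_event_def by (intro sets.finite_UN jump_event_measurable assms) auto
  have "disjoint_family_on (jump_event M N t m) (low_paths True h m n)"
    unfolding disjoint_family_on_def using len jump_event_unique by blast
  then have "prob (low_event t m n h) = (\<Sum>xs\<in>low_paths True h m n. prob (jump_event M N t m xs))"
    unfolding low_event_def
    by (intro finite_measure_finite_Union) (use len jump_event_measurable assms in auto)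
  also have "\<dots> = (\<Sum>xs\<in>low_paths True h m n. exp (- (rate * t)) * (rate * t / real m) ^ n)"
    by (intro sum.cong refl) (use prob_jump_event[OF assms] in \<open>auto simp: low_paths_def\<close>)
  finally show "prob (low_event t m n h) =
      real (card (low_paths True h m n)) * (exp (- (rate * t)) * (rate * t / real m) ^ n)"
    by simp
qed

lemma low_event_N:
  assumes "\<omega> \<in> low_event t m n h" "0 < t" "0 < m"
  shows "N t \<omega> = n"
  using assms jump_event_count[of \<omega> t m _ m] by (auto simp: low_event_def low_paths_def)

section \<open>Barrier events against the event on the maximum\<close>

lemma low_event_subset:
  assumes "0 < t" "0 < m" "0 \<le> c" "0 \<le> h" "c * t / real m * (of_int h + 2 * real n + 1) < \<beta>"
  shows "low_event t m n h \<subseteq> {\<omega> \<in> space M. telegraph_max (\<lambda>_. c) N t \<omega> < \<beta> \<and> N t \<omega> = n}"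
proof
  fix \<omega> assume *: "\<omega> \<in> low_event t m n h"
  then obtain xs where xs: "xs \<in> low_paths True h m n" "\<omega> \<in> jump_event M N t m xs"
    by (auto simp: low_event_def)
  have \<omega>: "\<omega> \<in> space M" using xs by (simp add: jump_event_def)
  have n: "N t \<omega> = n" using low_event_N[OF * assms(1,2)] .
  have "grid_sum N t m j \<omega> \<le> of_int h" if "j \<le> m" for j
    using jump_event_grid_sum[OF xs(2)] walk_position_le_if_stays_below[of True h xs j] xs(1) that assms
    by (simp add: low_paths_def)
  then have "telegraph_max (\<lambda>_. c) N t \<omega> \<le> c * t / real m * (of_int h + 2 * real (N t \<omega>) + 1)"
    using assms by (intro telegraph_max_le_grid_sum \<omega>) auto
  with assms(5) n \<omega> show "\<omega> \<in> {\<omega> \<in> space M. telegraph_max (\<lambda>_. c) N t \<omega> < \<beta> \<and> N t \<omega> = n}" by simp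
qed

text \<open>The second barrier \<open>h'\<close> is arbitrary: membership in its event supplies a
  pattern with at most one jump per cell. A walk that fails to stay below \<open>h\<close> reaches
  height \<open>h\<close>, which pushes the maximum up to \<open>\<beta>\<close>.\<close>

lemma low_event_if_telegraph_max_less:
  assumes "0 < t" "0 < m" "0 \<le> c" "\<beta> \<le> c * t / real m * (of_int h - 2 * real n)"
    and "telegraph_max (\<lambda>_. c) N t \<omega> < \<beta>" "\<omega> \<in> low_event t m n h'"
  shows "\<omega> \<in> low_event t m n h"
proof -
  obtain xs where xs: "xs \<in> low_paths True h' m n" "\<omega> \<in> jump_event M N t m xs"
    using assms(6) by (auto simp: low_event_def)
  have \<omega>: "\<omega> \<in> space M" using xs by (simp add: jump_event_def)
  have n: "N t \<omega> = n" using low_event_N[OF assms(6,1,2)] .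
  have len: "length xs = m" using xs by (simp add: low_paths_def)
  have "stays_below True h xs"
  proof (rule ccontr)
    assume "\<not> stays_below True h xs"
    then obtain j where j: "j \<le> m" "h \<le> walk_position True xs j"
      using walk_position_ge_if_not_stays_below len by blast
    then have "of_int h \<le> grid_sum N t m j \<omega>"
      using jump_event_grid_sum[OF xs(2) len j(1)] assms(1) by simp
    then have "c * t / real m * (of_int h - 2 * real n) \<le> c * t / real m * (grid_sum N t m j \<omega> - 2 * real n)"
      using assms by (intro mult_left_mono) auto
    also have "\<dots> \<le> telegraph_max (\<lambda>_. c) N t \<omega>"
      using grid_sum_le_telegraph_max[OF \<omega>, of t j m "\<lambda>_. c"] j(1) assms n by simp
    finally show False using assms by simp
  qed
  then show ?thesis using xs by (auto simp: low_event_def low_paths_def)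
qed

end

subsection \<open>The conditional law of the maximum\<close>

context poisson_process
begin

lemma N_events: "0 \<le> t \<Longrightarrow> {\<omega> \<in> space M. N t \<omega> = n} \<in> events"
  using measurable_sets[OF N_measurable, of t "{n}"] by (simp add: vimage_def Int_def conj_commute)

lemma prob_N_pos:
  assumes "0 < t"
  shows "0 < prob {\<omega> \<in> space M. N t \<omega> = n}"
  using rate_pos assms by (simp add: prob_N)

text \<open>The exponential and all powers of the rate cancel, leaving pure counting.\<close>

lemma prob_low_event_ratio:
  assumes "0 < t" "0 < m"
  shows "prob (low_event t m n h) / prob {\<omega> \<in> space M. N t \<omega> = n} =
    fact n * real (card (low_paths True h m n)) / real m ^ n"
  using rate_pos assms by (simp add: prob_low_event prob_N power_divide field_simps)

text \<open>Squeeze between two barriers \<open>u - v\<close> with \<open>u + v = m\<close> and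
  \<open>u / m\<close> tending to \<open>p\<close>: then \<open>(u - v) / m\<close> tends to
  \<open>2 p - 1 = \<beta> / (c t)\<close>, the scaled level.\<close>

lemma prob_telegraph_max_given_N:
  assumes "0 < c" "0 < t" "0 < \<beta>" "\<beta> < c * t"
  defines "p \<equiv> (1 + \<beta> / (c * t)) / 2"
  shows "prob {\<omega> \<in> space M. telegraph_max (\<lambda>_. c) N t \<omega> < \<beta> \<and> N t \<omega> = n} / prob {\<omega> \<in> space M. N t \<omega> = n}
    = binomial_sign p (1 - p) n"
proof -
  let ?PN = "prob {\<omega> \<in> space M. N t \<omega> = n}"
  let ?G = "{\<omega> \<in> space M. telegraph_max (\<lambda>_. c) N t \<omega> < \<beta> \<and> N t \<omega> = n}"
  let ?X = "prob ?G / ?PN"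
  have p: "1 / 2 < p" "p < 1" and \<beta>: "\<beta> = c * t * (2 * p - 1)"
    using assms(1-4) by (simp_all add: p_def field_simps)
  have ct: "0 \<le> c * t / real m" for m using assms(1,2) by simp
  \<comment> \<open>The shifts by \<open>n + 2\<close> and \<open>n\<close> move the barriers
    \<open>2 lo - m\<close> and \<open>2 hi - m\<close> far enough to absorb the grid errors
    \<open>2 n + 1\<close> and \<open>2 n\<close>.\<close>
  define lo where "lo m = nat \<lfloor>p * real m - real n - 2\<rfloor>" for m
  define hi where "hi m = nat \<lceil>p * real m + real n\<rceil>" for m
  have lo_bound: "\<bar>real (lo m) - p * real m\<bar> \<le> real n + 3" for m
  proof -
    have "0 \<le> p * real m" using p by simp
    then show ?thesis unfolding lo_def by linarith
  qed
  have hi_bound: "\<bar>real (hi m) - p * real m\<bar> \<le> real n + 3" for m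
  proof -
    have "0 \<le> p * real m" using p by simp
    then show ?thesis unfolding hi_def by linarith
  qed
  \<comment> \<open>As \<open>p\<close> lies strictly between \<open>1 / 2\<close> and
    \<open>1\<close>, eventually the barrier is positive and \<open>m - u\<close> is a genuine
    difference.\<close>
  have range: "\<forall>\<^sub>F m in sequentially. real m < 2 * real (u m) \<and> u m \<le> m"
    if u: "\<And>m. \<bar>real (u m) - p * real m\<bar> \<le> real n + 3" for u
  proof -
    have lim: "(\<lambda>m. real (u m) / real m) \<longlonglongrightarrow> p" by (rule tendsto_ratio_if_bounded_error[OF u])
    show ?thesis
      using order_tendstoD(1)[OF lim p(1)] order_tendstoD(2)[OF lim p(2)] eventually_gt_at_top[of 0]
      by eventually_elim (simp add: field_simps)
  qed
  have lim: "(\<lambda>m. fact n * of_int (signed_vandermonde 0 (u m) (m - u m) n) / real m ^ n)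
      \<longlonglongrightarrow> binomial_sign p (1 - p) n"
    if u: "\<And>m. \<bar>real (u m) - p * real m\<bar> \<le> real n + 3" for u
    unfolding binomial_sign_def
  proof (rule signed_vandermonde_asymptotics)
    show *: "(\<lambda>m. real (u m) / real m) \<longlonglongrightarrow> p" by (rule tendsto_ratio_if_bounded_error[OF u])
    show "(\<lambda>m. real (m - u m) / real m) \<longlonglongrightarrow> 1 - p"
    proof (rule Lim_transform_eventually)
      show "(\<lambda>m. 1 - real (u m) / real m) \<longlonglongrightarrow> 1 - p" by (intro tendsto_intros *)
      show "\<forall>\<^sub>F m in sequentially. 1 - real (u m) / real m = real (m - u m) / real m"
        using range[OF u] eventually_gt_at_top[of 0]
        by eventually_elim (simp add: of_nat_diff field_simps)
    qed
  qed
  have ratio: "prob (low_event t m n (2 * int u - int m)) / ?PN =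
      fact n * of_int (signed_vandermonde 0 u (m - u) n) / real m ^ n"
    if "0 < m" "m < 2 * u" "u \<le> m" for m u
  proof -
    have "int (card (low_paths True (2 * int u - int m) m n)) = signed_vandermonde 0 u (m - u) n"
      using card_low_paths[of "m - u" u True n] that by (simp add: algebra_simps of_nat_diff)
    then have "real (card (low_paths True (2 * int u - int m) m n)) = of_int (signed_vandermonde 0 u (m - u) n)"
      by (metis of_int_of_nat_eq)
    then show ?thesis using prob_low_event_ratio[OF assms(2) that(1)] by simp
  qed
  have G: "?G \<in> events"
  proof -
    have "telegraph_max (\<lambda>_. c) N t \<in> borel_measurable M"
      using assms by (intro borel_measurable_telegraph_max N_measurable) auto
    then have "{\<omega> \<in> space M. telegraph_max (\<lambda>_. c) N t \<omega> < \<beta>} \<in> events" by measurable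
    from sets.Int[OF this N_events[OF less_imp_le[OF assms(2)], of n]]
    show ?thesis by (rule back_subst[of "\<lambda>A. A \<in> events"]) blast
  qed
  have PN: "0 < ?PN" by (rule prob_N_pos[OF assms(2)])
  have "binomial_sign p (1 - p) n \<le> ?X"
  proof (rule tendsto_upperbound[OF lim[OF lo_bound] _ sequentially_bot])
    show "\<forall>\<^sub>F m in sequentially. fact n * of_int (signed_vandermonde 0 (lo m) (m - lo m) n) / real m ^ n \<le> ?X"
      using range[OF lo_bound] eventually_gt_at_top[of 0]
    proof eventually_elim
      case (elim m)
      \<comment> \<open>\<open>lo m\<close> is positive, so \<open>nat\<close> has not clipped a
        negative floor.\<close>
      have "0 < p * real m - real n - 2"
        using elim unfolding lo_def by linarith
      then have "real (lo m) \<le> p * real m - real n - 2" unfolding lo_def by linarith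
      then have "c * t / real m * (of_int (2 * int (lo m) - int m) + 2 * real n + 1)
          \<le> c * t / real m * ((2 * p - 1) * real m - 3)"
        using ct[of m] by (intro mult_left_mono) (auto simp: algebra_simps)
      also have "\<dots> = \<beta> - 3 * c * t / real m"
        using elim by (simp add: \<beta> field_simps)
      also have "\<dots> < \<beta>" using elim assms by simp
      finally have "low_event t m n (2 * int (lo m) - int m) \<subseteq> ?G"
        using elim assms by (intro low_event_subset) auto
      then have "prob (low_event t m n (2 * int (lo m) - int m)) / ?PN \<le> ?X"
        using PN by (intro divide_right_mono finite_measure_mono G) auto
      then show ?case using ratio[of m "lo m"] elim by simp
    qed
  qed
  moreover have "?X \<le> binomial_sign p (1 - p) n"
  proof (rule tendsto_lowerbound[OF _ _ sequentially_bot])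
    \<comment> \<open>This is the conditional probability that no cell carries two jumps; the upper
      bound loses only its complement.\<close>
    have "(\<lambda>m. fact n * real (m choose n) / real m ^ n) \<longlonglongrightarrow> 1 ^ n"
      by (rule choose_asymptotics[OF Lim_transform_eventually[OF tendsto_const]])
         (use eventually_gt_at_top[of 0] in eventually_elim, simp)
    from tendsto_add[OF lim[OF hi_bound] tendsto_diff[OF tendsto_const[of 1] this]]
    show "(\<lambda>m. fact n * of_int (signed_vandermonde 0 (hi m) (m - hi m) n) / real m ^ n
        + (1 - fact n * real (m choose n) / real m ^ n)) \<longlonglongrightarrow> binomial_sign p (1 - p) n"
      by simp
    show "\<forall>\<^sub>F m in sequentially. ?X \<le> fact n * of_int (signed_vandermonde 0 (hi m) (m - hi m) n) / real m ^ n
        + (1 - fact n * real (m choose n) / real m ^ n)"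
      using range[OF hi_bound] eventually_gt_at_top[of 0]
    proof eventually_elim
      case (elim m)
      let ?L = "low_event t m n (2 * int (hi m) - int m)"
      \<comment> \<open>The barrier \<open>m + 1\<close> cannot be reached in \<open>m\<close>
        steps, so \<open>?A\<close> consists of all single-jump patterns with \<open>n\<close>
        jumps.\<close>
      let ?A = "low_event t m n (int m + 1)"
      have "p * real m + real n \<le> real (hi m)" unfolding hi_def by linarith
      then have "c * t / real m * ((2 * p - 1) * real m)
          \<le> c * t / real m * (of_int (2 * int (hi m) - int m) - 2 * real n)"
        using ct[of m] by (intro mult_left_mono) (auto simp: algebra_simps)
      then have "\<beta> \<le> c * t / real m * (of_int (2 * int (hi m) - int m) - 2 * real n)"
        using elim by (simp add: \<beta>)
      then have "?G \<subseteq> ?L \<union> ({\<omega> \<in> space M. N t \<omega> = n} - ?A)"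
        using low_event_if_telegraph_max_less[of t m c \<beta> "2 * int (hi m) - int m" n _ "int m + 1"]
          elim assms by auto
      moreover have ev: "?L \<in> events" "?A \<in> events" "{\<omega> \<in> space M. N t \<omega> = n} \<in> events"
        using elim assms by (auto intro!: low_event_measurable N_events)
      ultimately have "prob ?G \<le> prob (?L \<union> ({\<omega> \<in> space M. N t \<omega> = n} - ?A))"
        by (intro finite_measure_mono) auto
      also have "\<dots> \<le> prob ?L + prob ({\<omega> \<in> space M. N t \<omega> = n} - ?A)"
        using ev by (intro measure_Un_le) auto
      also have "prob ({\<omega> \<in> space M. N t \<omega> = n} - ?A) = ?PN - prob ?A"
        using ev sets.sets_into_space[OF ev(2)] low_event_N elim assms
        by (intro finite_measure_Diff) auto
      finally have "?X \<le> (prob ?L + (?PN - prob ?A)) / ?PN"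
        using PN by (intro divide_right_mono) auto
      also have "\<dots> = prob ?L / ?PN + (1 - prob ?A / ?PN)"
        using PN by (simp add: field_simps)
      also have "prob ?A / ?PN = fact n * real (m choose n) / real m ^ n"
        using elim assms by (simp add: prob_low_event_ratio card_low_paths_unconstrained)
      finally show ?case using ratio[of m "hi m"] elim by simp
    qed
  qed
  ultimately show ?thesis by simp
qed

end

text \<open>On \<open>V0 = c\<close> the maximum is that of the path with constant initial velocity
  \<open>c\<close>, which is measurable for the sigma-algebra of \<open>N\<close>. Independence puts
  a factor \<open>1 / 2\<close> in numerator and denominator, and these cancel.\<close>

lemma (in symmetric_telegraph) cond_prob_telegraph_max:
  assumes "0 < t" "0 < \<beta>" "\<beta> < c * t"
  defines "p \<equiv> (1 + \<beta> / (c * t)) / 2"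
  shows "\<P>(\<omega> in M. telegraph_max V0 N t \<omega> < \<beta> \<bar> V0 \<omega> = c \<and> N t \<omega> = n) = binomial_sign p (1 - p) n"
proof -
  define W where "W = vimage_algebra (space M) (\<lambda>\<omega>. \<lambda>t\<in>{0..}. N t \<omega>) (Pi\<^sub>M {0..} (\<lambda>_. count_space UNIV))"
  define V where "V = {\<omega> \<in> space M. V0 \<omega> = c}"
  have space: "space W = space M" by (simp add: W_def)
  have path: "(\<lambda>\<omega>. \<lambda>t\<in>{0..}. N t \<omega>) \<in> measurable W (Pi\<^sub>M {0..} (\<lambda>_. count_space UNIV))"
    unfolding W_def by (rule measurable_vimage_algebra1) (auto simp: space_PiM)
  have N_W: "N s \<in> measurable W (count_space UNIV)" if "0 \<le> s" for s
  proof -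
    have "s \<in> {0..}" using that by simp
    from measurable_compose[OF path measurable_component_singleton[OF this]] that show ?thesis
      by simp
  qed
  have V: "V \<in> sets (vimage_algebra (space M) V0 borel)"
  proof -
    have "V = V0 -` {c} \<inter> space M" by (auto simp: V_def)
    then show ?thesis by (auto intro!: in_vimage_algebra)
  qed
  have indep: "prob (V \<inter> A) = 1 / 2 * prob A" if "A \<in> sets W" for A
    using indep_setD[OF V0_N_indep V, of A] that V0_pos by (simp add: W_def V_def)
  have NW: "{\<omega> \<in> space M. N t \<omega> = n} \<in> sets W"
    using measurable_sets[OF N_W, of t "{n}"] assms(1)
    by (simp add: space vimage_def Int_def conj_commute)
  have "telegraph_max (\<lambda>_. c) N t \<in> borel_measurable W"
    using assms(1) speed_pos by (intro borel_measurable_telegraph_max space N_W) auto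
  then have "{\<omega> \<in> space M. telegraph_max (\<lambda>_. c) N t \<omega> < \<beta>} \<in> sets W"
    unfolding space[symmetric] by measurable
  from sets.Int[OF this NW]
  have GW: "{\<omega> \<in> space M. telegraph_max (\<lambda>_. c) N t \<omega> < \<beta> \<and> N t \<omega> = n} \<in> sets W"
    by (rule back_subst[of "\<lambda>A. A \<in> sets W"]) blast
  have "telegraph_max V0 N t \<omega> = telegraph_max (\<lambda>_. c) N t \<omega>" if "V0 \<omega> = c" for \<omega>
    by (simp add: telegraph_max_def telegraph_def that)
  then have "{\<omega> \<in> space M. telegraph_max V0 N t \<omega> < \<beta> \<and> V0 \<omega> = c \<and> N t \<omega> = n} =
      V \<inter> {\<omega> \<in> space M. telegraph_max (\<lambda>_. c) N t \<omega> < \<beta> \<and> N t \<omega> = n}"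
    and "{\<omega> \<in> space M. V0 \<omega> = c \<and> N t \<omega> = n} = V \<inter> {\<omega> \<in> space M. N t \<omega> = n}"
    by (auto simp: V_def)
  then show ?thesis
    using prob_telegraph_max_given_N[OF speed_pos assms(1-3), of n]
    by (simp add: cond_prob_def indep[OF NW] indep[OF GW] p_def)
qed

theorem corollary5p1:
  fixes M :: "'a measure" and N :: "real \<Rightarrow> 'a \<Rightarrow> nat" and V0 :: "'a \<Rightarrow> real"
    and c lam t \<beta> :: real and k :: nat
  assumes "c > 0" and "lam > 0"
    and "symmetric_telegraph M lam N c V0"
    and "t > 0" and "0 < \<beta>" and "\<beta> < c * t"
  shows "\<P>(\<omega> in M. telegraph_max V0 N t \<omega> < \<beta> \<bar> V0 \<omega> = c \<and> N t \<omega> = 2 * k + 2)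
       = \<P>(\<omega> in M. telegraph_max V0 N t \<omega> < \<beta> \<bar> V0 \<omega> = c \<and> N t \<omega> = 2 * k + 1)
    \<and> \<P>(\<omega> in M. telegraph_max V0 N t \<omega> < \<beta> \<bar> V0 \<omega> = c \<and> N t \<omega> = 2 * k + 1)
       = \<beta> / (c * t) * (\<Sum>j=0..k. real ((2 * j) choose j) *
           (sqrt (c\<^sup>2 * t\<^sup>2 - \<beta>\<^sup>2) / (2 * c * t)) ^ (2 * j))"
proof -
  interpret symmetric_telegraph M lam N c V0 by fact
  define p where "p = (1 + \<beta> / (c * t)) / 2"
  \<comment> \<open>A nonnegative radicand lets the square undo the root; what remains is
    \<open>p * (1 - p) = (1 - (2 * p - 1)\<^sup>2) / 4\<close>.\<close>
  have "\<beta>\<^sup>2 \<le> (c * t)\<^sup>2" using assms by (intro power_mono) auto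
  then have "(sqrt (c\<^sup>2 * t\<^sup>2 - \<beta>\<^sup>2) / (2 * c * t))\<^sup>2 = p * (1 - p)"
    using assms by (simp add: p_def power_divide power_mult_distrib field_simps power2_eq_square)
  moreover have "p - (1 - p) = \<beta> / (c * t)" by (simp add: p_def field_simps)
  ultimately show ?thesis
    using cond_prob_telegraph_max[OF assms(4-6), folded p_def]
      binomial_sign_even[of p "1 - p" k] binomial_sign_closed_form[of p "1 - p" k]
    by (simp add: power_mult del: of_nat_mult)
qed

end
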